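(* Let $n \ge 1$ be an integer and let $X \subset \mathbf{Z}/n\mathbf{Z}$. If $X$ is coprime-sum-free, then $|X| \le \frac{2}{3} n$. In fact the same bound $|X| \le \frac23 n$ holds under only the following weaker assumption: \begin{itemize} \item if $n$ is odd: there is no $x \in \mathbf{Z}/n\mathbf{Z}$ such that $x,\ x+1,\ 2x+1$ all belong to $X$; \item if $n$ is even: there are no odd $x \in \mathbf{Z}/n\mathbf{Z}$ and $h \in \{2,4,8\}$ such that $x,\ x+h,\ 2x+h$ all belong to $X$. \end{itemize}
   Context: A subset $X \subset \mathbf{Z}/n\mathbf{Z}$ is called coprime-sum-free if there do not exist $x, y \in X$ (not necessarily distinct) with $x + y \in X$ and $\gcd(x, y, n) = 1$. Here $\gcd(x,y,n)$ is computed using any integer representatives of $x$ and $y$; it does not depend on the choice. For $n$ even, the parity of an element of $\mathbf{Z}/n\mathbf{Z}$ is well-defined. *)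

theory Defs
  imports Complex_Main "HOL-Number_Theory.Residues"
begin

text \<open>
  \<open>\<int>/n\<int>\<close> is \<^term>\<open>residue_ring (int n)\<close>, whose carrier consists of the representatives
  \<open>0, \<dots>, n - 1\<close>. This is also meant for \<open>n = 1\<close>, where the record field \<open>one\<close> of the library
  ring is \<open>1\<close> and so lies outside the carrier \<open>{0}\<close>; the residue class of an integer \<open>k\<close>
  is therefore always written \<open>k mod int n\<close>.
\<close>

definition coprime_sum_free :: "nat \<Rightarrow> int set \<Rightarrow> bool" where
  "coprime_sum_free n X \<longleftrightarrow>
     \<not> (\<exists>x\<in>X. \<exists>y\<in>X. x \<oplus>\<^bsub>residue_ring (int n)\<^esub> y \<in> X \<and> Gcd {x, y, int n} = 1)"

definition no_shifted_triple :: "nat \<Rightarrow> int set \<Rightarrow> bool" where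
  "no_shifted_triple n X \<longleftrightarrow>
     (odd n \<longrightarrow>
        \<not> (\<exists>x\<in>carrier (residue_ring (int n)).
             x \<in> X \<and> (x + 1) mod int n \<in> X \<and> (2 * x + 1) mod int n \<in> X)) \<and>
     (even n \<longrightarrow>
        \<not> (\<exists>x\<in>carrier (residue_ring (int n)). \<exists>h\<in>{2, 4, 8}.
             odd x \<and> x \<in> X \<and> (x + h) mod int n \<in> X \<and> (2 * x + h) mod int n \<in> X))"

end

theory Submission
  imports Defs
begin

text \<open>
  Let \<open>f\<close> be the indicator function of \<open>X\<close>, as an \<open>n\<close>-periodic function on the integers.

  For odd \<open>n\<close> the hypothesis gives \<open>f x + f (x + 1) + f (2 x + 1) \<le> 2\<close>, and each of the three
  terms sums to \<open>|X|\<close> over a period.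

  For \<open>n = 2 N\<close> put \<open>g i = f (2 i + 1)\<close> and \<open>e i = f (2 i)\<close>, of period \<open>N\<close>; the hypothesis says
  that \<open>g i g (i + k) \<le> 1 - e (2 i + 1 + k)\<close> for \<open>k = 1, 2, 4\<close>. If \<open>g = 1\<close> at \<open>s\<close> points of
  a triple, then \<open>s \<le> 1 + s (s - 1) / 2\<close>. For the triples \<open>i, i + 1, i + 2\<close> and
  \<open>i, i + 2, i + 4\<close> this bounds \<open>3 \<Sum>g\<close> by \<open>N + 2 r\<^sub>1 + r\<^sub>2\<close> and \<open>N + 2 r\<^sub>2 + r\<^sub>4\<close>,
  where \<open>r\<^sub>k\<close> is the sum of \<open>g i g (i + k)\<close>. Weighting the two bounds \<open>3 : 1\<close> makes the sums of
  \<open>e\<close> over even and over odd arguments enter equally, whatever the parity of \<open>N\<close>.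
\<close>

text \<open>Since \<open>a\<close> is a unit modulo \<open>n\<close>, the map
  \<open>x \<mapsto> a * x + k\<close> permutes the residues.\<close>

lemma sum_periodic_affine:
  fixes f :: "int \<Rightarrow> 'a::comm_monoid_add" and n a k :: int
  assumes "n > 0" and "coprime a n" and per: "\<And>x. f (x mod n) = f x"
  shows "(\<Sum>x\<in>{0..<n}. f (a * x + k)) = (\<Sum>x\<in>{0..<n}. f x)"
proof -
  let ?p = "\<lambda>x. (a * x + k) mod n"
  have inj: "inj_on ?p {0..<n}"
  proof (rule inj_onI)
    fix x y assume xy: "x \<in> {0..<n}" "y \<in> {0..<n}" and "?p x = ?p y"
    then have "n dvd (a * x + k) - (a * y + k)"
      by (simp only: mod_eq_dvd_iff)
    then have "n dvd a * (x - y)"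
      by (simp add: algebra_simps)
    then have "n dvd x - y"
      using assms(2) by (simp add: coprime_dvd_mult_right_iff coprime_commute)
    then have "x mod n = y mod n"
      by (simp add: mod_eq_dvd_iff)
    then show "x = y" using xy by simp
  qed
  have "?p ` {0..<n} = {0..<n}"
    using inj assms(1) by (intro endo_inj_surj) auto
  then have "(\<Sum>x\<in>{0..<n}. f x) = (\<Sum>x\<in>{0..<n}. f (?p x))"
    using sum.reindex[OF inj, of f] by simp
  then show ?thesis by (simp add: per)
qed

lemma sum_periodic_shift:
  fixes f :: "int \<Rightarrow> 'a::comm_monoid_add"
  assumes "n > 0" and "\<And>x. f (x mod n) = f x"
  shows "(\<Sum>x\<in>{0..<n}. f (x + k)) = (\<Sum>x\<in>{0..<n}. f x)"
  using sum_periodic_affine[of n 1 f k] assms by simp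

lemma sum_even_odd_split:
  fixes f :: "int \<Rightarrow> 'a::comm_monoid_add"
  shows "(\<Sum>x\<in>{0..<2 * int N}. f x) = (\<Sum>i\<in>{0..<int N}. f (2 * i) + f (2 * i + 1))"
proof (induction N)
  case (Suc N)
  have "{0..<2 * int (Suc N)} = insert (2 * int N + 1) (insert (2 * int N) {0..<2 * int N})"
    "{0..<int (Suc N)} = insert (int N) {0..<int N}"
    by auto
  with Suc.IH show ?case by (simp add: ac_simps)
qed simp

lemma sum_two_periods:
  fixes f :: "int \<Rightarrow> int"
  assumes per: "\<And>x. f (x mod int N) = f x"
  shows "(\<Sum>x\<in>{0..<2 * int N}. f x) = 2 * (\<Sum>x\<in>{0..<int N}. f x)"
proof -
  have "{0..<2 * int N} = {0..<int N} \<union> (\<lambda>x. x + int N) ` {0..<int N}"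
    unfolding image_add_atLeastLessThan' by auto
  moreover have "{0..<int N} \<inter> (\<lambda>x. x + int N) ` {0..<int N} = {}"
    by auto
  moreover have "f (x + int N) = f x" for x
    by (metis per mod_add_self2)
  ultimately show ?thesis
    by (simp add: sum.union_disjoint sum.reindex inj_on_def del: image_add_atLeastLessThan')
qed

lemma periodic_triple_bound:
  fixes g :: "int \<Rightarrow> int"
  assumes "N > 0" and per: "\<And>x. g (x mod N) = g x" and g: "\<And>x. g x \<in> {0, 1}"
  shows "3 * (\<Sum>i\<in>{0..<N}. g i) \<le>
    N + 2 * (\<Sum>i\<in>{0..<N}. g i * g (i + k)) + (\<Sum>i\<in>{0..<N}. g i * g (i + 2 * k))"
proof -
  \<comment> \<open>The last argument of the middle product is written \<open>i + k + k\<close> so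
    that this product is a shift of \<open>g i * g (i + k)\<close>; hence the coefficient 2 in the
    bound.\<close>
  have "g i + g (i + k) + g (i + 2 * k) \<le>
      1 + g i * g (i + k) + g (i + k) * g (i + k + k) + g i * g (i + 2 * k)" for i
    using g[of i] g[of "i + k"] g[of "i + 2 * k"] by (auto simp: algebra_simps)
  then have "(\<Sum>i\<in>{0..<N}. g i + g (i + k) + g (i + 2 * k)) \<le> (\<Sum>i\<in>{0..<N}.
      1 + g i * g (i + k) + g (i + k) * g (i + k + k) + g i * g (i + 2 * k))"
    by (rule sum_mono)
  moreover have "(\<Sum>i\<in>{0..<N}. g (i + k) * g (i + k + k)) = (\<Sum>i\<in>{0..<N}. g i * g (i + k))"
    using assms(1)
  proof (rule sum_periodic_shift[where f = "\<lambda>i. g i * g (i + k)"])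
    show "g (x mod N) * g (x mod N + k) = g x * g (x + k)" for x
      by (metis per mod_add_left_eq)
  qed
  moreover have "(\<Sum>i\<in>{0..<N}. g (i + j)) = (\<Sum>i\<in>{0..<N}. g i)" for j
    using assms(1) per by (rule sum_periodic_shift)
  ultimately show ?thesis
    using assms(1) by (simp add: sum.distrib)
qed

lemma odd_period_bound:
  fixes f :: "int \<Rightarrow> int"
  assumes "n > 0" "odd n" and per: "\<And>x. f (x mod n) = f x" and f: "\<And>x. f x \<in> {0, 1}"
    and free: "\<And>x. \<not> (f x = 1 \<and> f (x + 1) = 1 \<and> f (2 * x + 1) = 1)"
  shows "3 * (\<Sum>x\<in>{0..<n}. f x) \<le> 2 * n"
proof -
  have "f x + f (x + 1) + f (2 * x + 1) \<le> 2" for x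
    using f[of x] f[of "x + 1"] f[of "2 * x + 1"] free[of x] by auto
  then have "(\<Sum>x\<in>{0..<n}. f x + f (x + 1) + f (2 * x + 1)) \<le> (\<Sum>x\<in>{0..<n}. 2)"
    by (rule sum_mono)
  \<comment> \<open>Oddness of \<open>n\<close> enters here: 2 is a unit.\<close>
  moreover have "(\<Sum>x\<in>{0..<n}. f (2 * x + 1)) = (\<Sum>x\<in>{0..<n}. f x)"
    using assms by (intro sum_periodic_affine) auto
  moreover have "(\<Sum>x\<in>{0..<n}. f (x + 1)) = (\<Sum>x\<in>{0..<n}. f x)"
    using assms(1) per by (rule sum_periodic_shift)
  ultimately show ?thesis
    using assms(1) by (simp add: sum.distrib)
qed

lemma even_period_bound:
  fixes f :: "int \<Rightarrow> int"
  assumes "N > 0" and per: "\<And>x. f (x mod (2 * int N)) = f x" and f: "\<And>x. f x \<in> {0, 1}"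
    and free: "\<And>x h. odd x \<Longrightarrow> h \<in> {2, 4, 8} \<Longrightarrow>
      \<not> (f x = 1 \<and> f (x + h) = 1 \<and> f (2 * x + h) = 1)"
  shows "3 * (\<Sum>x\<in>{0..<2 * int N}. f x) \<le> 4 * int N"
proof -
  define g where "g i = f (2 * i + 1)" for i
  define e where "e i = f (2 * i)" for i
  define r where "r k = (\<Sum>i\<in>{0..<int N}. g i * g (i + k))" for k
  define S where "S k = (\<Sum>i\<in>{0..<int N}. e (2 * i + 1 + k))" for k
  have N: "int N > 0" using assms(1) by simp
  have eper: "e (x mod int N) = e x" for x
    by (simp only: e_def mult_mod_right per)
  have gper: "g (x mod int N) = g x" for x
  proof -
    have "(2 * (x mod int N) + 1) mod (2 * int N) = (2 * x + 1) mod (2 * int N)"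
      by (simp only: mult_mod_right mod_add_left_eq)
    then show ?thesis unfolding g_def by (metis per)
  qed
  have g: "g x \<in> {0, 1}" for x using f by (simp add: g_def)
  have r_le: "r k \<le> int N - S k" if "k \<in> {1, 2, 4}" for k
  proof -
    have "g i * g (i + k) \<le> 1 - e (2 * i + 1 + k)" for i
    proof -
      \<comment> \<open>Take \<open>x = 2 * i + 1\<close> and \<open>h = 2 * k\<close>; then
        \<open>2 * x + h\<close> is twice \<open>2 * i + 1 + k\<close>.\<close>
      have "\<not> (g i = 1 \<and> g (i + k) = 1 \<and> e (2 * i + 1 + k) = 1)"
        using free[of "2 * i + 1" "2 * k"] that by (auto simp: g_def e_def algebra_simps)
      then show ?thesis
        using g[of i] g[of "i + k"] f[of "2 * (2 * i + 1 + k)"] by (auto simp: e_def)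
    qed
    then have "r k \<le> (\<Sum>i\<in>{0..<int N}. 1 - e (2 * i + 1 + k))"
      unfolding r_def by (rule sum_mono)
    then show ?thesis by (simp add: S_def sum_subtractf)
  qed
  \<comment> \<open>2 and 4 have the same parity, so the two sums differ only by the shift
    \<open>i \<mapsto> i + 1\<close>.\<close>
  have "S 4 = (\<Sum>i\<in>{0..<int N}. e (2 * (i + 1) + 1 + 2))"
    by (simp add: S_def algebra_simps)
  also have "\<dots> = S 2"
    unfolding S_def using N
  proof (rule sum_periodic_shift[where f = "\<lambda>i. e (2 * i + 1 + 2)"])
    show "e (2 * (x mod int N) + 1 + 2) = e (2 * x + 1 + 2)" for x
    proof -
      have "(2 * (x mod int N) + 1 + 2) mod int N = (2 * x + 1 + 2) mod int N"
        by (intro mod_add_cong mod_mult_right_eq refl)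
      then show ?thesis by (metis eper)
    qed
  qed
  finally have S4: "S 4 = S 2" .
  \<comment> \<open>\<open>S 1\<close> and \<open>S 2\<close> cover the even and the odd
    \<open>x\<close> in two full periods of \<open>e\<close>, so the parity of \<open>N\<close> is
    irrelevant.\<close>
  have "S 1 + S 2 = (\<Sum>x\<in>{0..<2 * int N}. e (x + 2))"
    unfolding sum_even_odd_split S_def sum.distrib by (simp add: algebra_simps)
  also have "\<dots> = 2 * (\<Sum>i\<in>{0..<int N}. e (i + 2))"
    by (rule sum_two_periods) (metis eper mod_add_left_eq)
  also have "(\<Sum>i\<in>{0..<int N}. e (i + 2)) = (\<Sum>i\<in>{0..<int N}. e i)"
    using N eper by (rule sum_periodic_shift)
  finally have S12: "S 1 + S 2 = 2 * (\<Sum>i\<in>{0..<int N}. e i)" .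
  have "3 * (\<Sum>i\<in>{0..<int N}. g i) \<le> int N + 2 * r 1 + r 2"
    "3 * (\<Sum>i\<in>{0..<int N}. g i) \<le> int N + 2 * r 2 + r 4"
    using periodic_triple_bound[of "int N" g 1, OF N gper g]
      periodic_triple_bound[of "int N" g 2, OF N gper g] by (simp_all add: r_def)
  \<comment> \<open>Three times the first bound plus the second leaves
    \<open>6 * r 1 + 5 * r 2 + r 4\<close>, and \<open>S 4 = S 2\<close> turns this into at most
    \<open>12 * N - 6 * (S 1 + S 2)\<close>.\<close>
  then have "12 * (\<Sum>i\<in>{0..<int N}. g i) + 6 * (S 1 + S 2) \<le> 16 * int N"
    using r_le[of 1] r_le[of 2] r_le[of 4] S4 by simp
  moreover have "(\<Sum>x\<in>{0..<2 * int N}. f x) =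
      (\<Sum>i\<in>{0..<int N}. e i) + (\<Sum>i\<in>{0..<int N}. g i)"
    by (simp add: sum_even_odd_split e_def g_def sum.distrib)
  ultimately show ?thesis using S12 by simp
qed

lemma carrier_residue_ring: "carrier (residue_ring m) = {0..<m}"
  by (auto simp: residue_ring_def)

lemma no_shifted_triple_card_le:
  assumes "n \<ge> 1" and X: "X \<subseteq> carrier (residue_ring (int n))" and free: "no_shifted_triple n X"
  shows "3 * card X \<le> 2 * n"
proof -
  define f :: "int \<Rightarrow> int" where "f x = of_bool (x mod int n \<in> X)" for x
  have n: "int n > 0" using assms(1) by simp
  have range: "x mod int n \<in> carrier (residue_ring (int n))" for x
    using n by (simp add: carrier_residue_ring)
  have f: "f x \<in> {0, 1}" and per: "f (x mod int n) = f x" for x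
    by (simp_all add: f_def)
  have "(\<Sum>x\<in>{0..<int n}. f x) = (\<Sum>x\<in>{0..<int n}. of_bool (x \<in> X))"
    by (intro sum.cong) (auto simp: f_def)
  also have "\<dots> = int (card ({0..<int n} \<inter> X))"
    by (simp add: sum.If_cases of_bool_def)
  also have "{0..<int n} \<inter> X = X"
    using X by (auto simp: carrier_residue_ring)
  finally have sum_f: "(\<Sum>x\<in>{0..<int n}. f x) = int (card X)" .
  have shift: "(x mod int n + h) mod int n = (x + h) mod int n"
    "(2 * (x mod int n) + h) mod int n = (2 * x + h) mod int n" for x h
    by (simp add: mod_add_left_eq, intro mod_add_cong mod_mult_right_eq refl)
  have "3 * (\<Sum>x\<in>{0..<int n}. f x) \<le> 2 * int n"
  proof (cases "even n")
    case False
    have "\<not> (f x = 1 \<and> f (x + 1) = 1 \<and> f (2 * x + 1) = 1)" for x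
      using free False range[of x] shift[of x 1] by (auto simp: no_shifted_triple_def f_def)
    then show ?thesis
      using n False per f by (intro odd_period_bound) auto
  next
    case True
    then obtain N where N: "n = 2 * N" by (elim evenE)
    have "\<not> (f x = 1 \<and> f (x + h) = 1 \<and> f (2 * x + h) = 1)" if "odd x" "h \<in> {2, 4, 8}" for x h
    proof -
      \<comment> \<open>Reduction modulo an even \<open>n\<close> preserves parity.\<close>
      have "odd (x mod int n)"
        using that(1) True by (simp add: dvd_mod_iff)
      then show ?thesis
        using free True range[of x] that(2) shift[of x h]
        unfolding no_shifted_triple_def f_def by fastforce
    qed
    then show ?thesis
      using even_period_bound[of N f] n per f unfolding N by simp
  qed
  then show ?thesis unfolding sum_f by linarith
qed

text \<open>A common divisor divides \<open>m\<close>, hence also the unreduced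
  \<open>x + h\<close>, and therefore \<open>h\<close>.\<close>

lemma Gcd_shift_eq_1:
  fixes x h m :: int
  assumes "coprime x h"
  shows "Gcd {x, (x + h) mod m, m} = 1"
proof -
  let ?d = "Gcd {x, (x + h) mod m, m}"
  have d: "?d dvd x" "?d dvd (x + h) mod m" "?d dvd m"
    by (rule Gcd_dvd; simp)+
  then have "?d dvd x + h" using dvd_mod_imp_dvd by blast
  with d(1) have "?d dvd h" by (simp add: dvd_add_right_iff)
  with d(1) assms have "is_unit ?d" using coprime_common_divisor by blast
  then show ?thesis by simp
qed

text \<open>A triple \<open>x, x + h, 2 * x + h\<close> is a sum \<open>x + y\<close> with
  \<open>y = x + h\<close>, and \<open>x\<close> is coprime to \<open>h\<close>: either
  \<open>h = 1\<close>, or \<open>x\<close> is odd and \<open>h\<close> is a power of 2.\<close>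

lemma coprime_sum_free_imp_no_shifted_triple:
  assumes "coprime_sum_free n X"
  shows "no_shifted_triple n X"
proof -
  have *: "(2 * x + h) mod int n \<notin> X" if "x \<in> X" "(x + h) mod int n \<in> X" "coprime x h" for x h
  proof -
    have "x \<oplus>\<^bsub>residue_ring (int n)\<^esub> ((x + h) mod int n) = (2 * x + h) mod int n"
      by (simp add: residue_ring_def mod_add_right_eq algebra_simps)
    then show ?thesis
      using assms that Gcd_shift_eq_1[of x h "int n"] unfolding coprime_sum_free_def by metis
  qed
  have "coprime x h" if "odd x" "h \<in> {2, 4, 8}" for x h :: int
  proof -
    have "coprime x (2 ^ 3)"
      unfolding coprime_power_right_iff using that(1) by simp
    moreover have "h dvd 2 ^ 3" using that(2) by auto
    ultimately show ?thesis using coprime_divisors dvd_refl by blast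
  qed
  with * show ?thesis
    unfolding no_shifted_triple_def by (metis coprime_1_right)
qed

theorem proposition5p4:
  fixes n :: nat and X :: "int set"
  assumes "n \<ge> 1"
    and "X \<subseteq> carrier (residue_ring (int n))"
  shows "(coprime_sum_free n X \<longrightarrow> real (card X) \<le> 2 / 3 * real n) \<and>
         (coprime_sum_free n X \<longrightarrow> no_shifted_triple n X) \<and>
         (no_shifted_triple n X \<longrightarrow> real (card X) \<le> 2 / 3 * real n)"
proof -
  have "real (card X) \<le> 2 / 3 * real n" if "no_shifted_triple n X"
    using no_shifted_triple_card_le[OF assms that] by linarith
  then show ?thesis using coprime_sum_free_imp_no_shifted_triple by blast
qed

end
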